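(* Let $R$ be a ring, $\sigma$ an endomorphism of $R$, $\delta$ a $\sigma$-derivation of $R$, and $M_R$ a right $R$-module. If $\sigma$ is bijective and $M_R$ is completely $(\sigma,\delta)$-compatible, then $M_R$ is completely $(\sigma',\delta')$-compatible, where $\sigma'=\sigma^{-1}$ and $\delta'=-\delta\sigma^{-1}$.
   Context: Rings are associative with identity, not necessarily commutative; modules are right modules. A $\sigma$-derivation of $R$ is an additive map $\delta:R\to R$ with $\delta(rs)=\sigma(r)\delta(s)+\delta(r)s$ for all $r,s\in R$. Here $\delta'(r)=-\delta(\sigma^{-1}(r))$. For maps $\alpha,\beta:R\to R$ (used with $(\alpha,\beta)=(\sigma,\delta)$ and with $(\alpha,\beta)=(\sigma',\delta')$), a right module $L_R$ is $\alpha$-compatible if for all $m\in L$, $r\in R$: $mr=0$ if and only if $m\alpha(r)=0$; and (in the derivation slot) $\beta$-compatible if $mr=0$ implies $m\beta(r)=0$ for all $m\in L$, $r\in R$. $L_R$ is completely $(\alpha,\beta)$-compatible if for every submodule $N_R$ of $L_R$ the quotient $(L/N)_R$ is $\alpha$-compatible and $\beta$-compatible in these senses. *)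

theory Defs
  imports "HOL-Algebra.Module" "HOL-Algebra.QuotRing"
begin

text \<open>
  \<^locale>\<open>module\<close> requires a commutative ring of scalars, so right modules over an arbitrary ring are
  introduced here.  They live in the library's record type, whose scalar multiplication takes the
  scalar first: the product of a module element \<open>m\<close> by a scalar \<open>r\<close> on the right is stored as
  \<open>smult M r m\<close>.  That \<open>M\<close> is a right (not a left) module is expressed by \<open>rsmult_assoc\<close> below.
  The library predicate \<^const>\<open>submodule\<close> does not refer to commutativity or to the side of the
  action, hence it is the notion of a submodule of a right module as well.
\<close>

abbreviation rsmult :: "('r, 'm, 'x) module_scheme \<Rightarrow> 'm \<Rightarrow> 'r \<Rightarrow> 'm" (infixl \<open>\<bullet>\<index>\<close> 70)
  where "m \<bullet>\<^bsub>M\<^esub> r \<equiv> smult M r m"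

locale right_module = R?: ring R + M?: abelian_group M for R (structure) and M (structure) +
  assumes rsmult_closed:
      "\<lbrakk>x \<in> carrier M; a \<in> carrier R\<rbrakk> \<Longrightarrow> x \<bullet>\<^bsub>M\<^esub> a \<in> carrier M"
    and rsmult_l_distr:
      "\<lbrakk>x \<in> carrier M; y \<in> carrier M; a \<in> carrier R\<rbrakk> \<Longrightarrow>
        (x \<oplus>\<^bsub>M\<^esub> y) \<bullet>\<^bsub>M\<^esub> a = x \<bullet>\<^bsub>M\<^esub> a \<oplus>\<^bsub>M\<^esub> y \<bullet>\<^bsub>M\<^esub> a"
    and rsmult_r_distr:
      "\<lbrakk>x \<in> carrier M; a \<in> carrier R; b \<in> carrier R\<rbrakk> \<Longrightarrow>
        x \<bullet>\<^bsub>M\<^esub> (a \<oplus>\<^bsub>R\<^esub> b) = x \<bullet>\<^bsub>M\<^esub> a \<oplus>\<^bsub>M\<^esub> x \<bullet>\<^bsub>M\<^esub> b"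
    and rsmult_assoc:
      "\<lbrakk>x \<in> carrier M; a \<in> carrier R; b \<in> carrier R\<rbrakk> \<Longrightarrow>
        x \<bullet>\<^bsub>M\<^esub> (a \<otimes>\<^bsub>R\<^esub> b) = (x \<bullet>\<^bsub>M\<^esub> a) \<bullet>\<^bsub>M\<^esub> b"
    and rsmult_one:
      "x \<in> carrier M \<Longrightarrow> x \<bullet>\<^bsub>M\<^esub> \<one>\<^bsub>R\<^esub> = x"

text \<open>
  The quotient by a submodule, on additive cosets as in \<^const>\<open>FactRing\<close>.  The fields \<open>mult\<close> and
  \<open>one\<close> of the module record carry no meaning for modules.
\<close>

definition quotient_module ::
    "('r, 'm, 'x) module_scheme \<Rightarrow> 'm set \<Rightarrow> ('r, 'm set) module"
  where "quotient_module M N =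
    \<lparr>carrier = a_rcosets\<^bsub>M\<^esub> N, mult = undefined, one = undefined,
     zero = N, add = set_add M,
     smult = (\<lambda>r X. \<Union>x\<in>X. N +>\<^bsub>M\<^esub> (x \<bullet>\<^bsub>M\<^esub> r))\<rparr>"

definition skew_derivation :: "('r, 'y) ring_scheme \<Rightarrow> ('r \<Rightarrow> 'r) \<Rightarrow> ('r \<Rightarrow> 'r) \<Rightarrow> bool"
  where "skew_derivation R \<sigma> \<delta> \<longleftrightarrow>
    \<delta> \<in> carrier R \<rightarrow> carrier R \<and>
    (\<forall>r\<in>carrier R. \<forall>s\<in>carrier R. \<delta> (r \<oplus>\<^bsub>R\<^esub> s) = \<delta> r \<oplus>\<^bsub>R\<^esub> \<delta> s) \<and>
    (\<forall>r\<in>carrier R. \<forall>s\<in>carrier R.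
      \<delta> (r \<otimes>\<^bsub>R\<^esub> s) = \<sigma> r \<otimes>\<^bsub>R\<^esub> \<delta> s \<oplus>\<^bsub>R\<^esub> \<delta> r \<otimes>\<^bsub>R\<^esub> s)"

definition endo_compatible ::
    "('r, 'y) ring_scheme \<Rightarrow> ('r, 'm, 'x) module_scheme \<Rightarrow> ('r \<Rightarrow> 'r) \<Rightarrow> bool"
  where "endo_compatible R L \<alpha> \<longleftrightarrow>
    (\<forall>m\<in>carrier L. \<forall>r\<in>carrier R. m \<bullet>\<^bsub>L\<^esub> r = \<zero>\<^bsub>L\<^esub> \<longleftrightarrow> m \<bullet>\<^bsub>L\<^esub> \<alpha> r = \<zero>\<^bsub>L\<^esub>)"

definition deriv_compatible ::
    "('r, 'y) ring_scheme \<Rightarrow> ('r, 'm, 'x) module_scheme \<Rightarrow> ('r \<Rightarrow> 'r) \<Rightarrow> bool"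
  where "deriv_compatible R L \<beta> \<longleftrightarrow>
    (\<forall>m\<in>carrier L. \<forall>r\<in>carrier R. m \<bullet>\<^bsub>L\<^esub> r = \<zero>\<^bsub>L\<^esub> \<longrightarrow> m \<bullet>\<^bsub>L\<^esub> \<beta> r = \<zero>\<^bsub>L\<^esub>)"

definition completely_compatible ::
    "('r, 'y) ring_scheme \<Rightarrow> ('r, 'm, 'x) module_scheme \<Rightarrow> ('r \<Rightarrow> 'r) \<Rightarrow> ('r \<Rightarrow> 'r) \<Rightarrow> bool"
  where "completely_compatible R L \<alpha> \<beta> \<longleftrightarrow>
    (\<forall>N. submodule N R L \<longrightarrow>
      endo_compatible R (quotient_module L N) \<alpha> \<and>
      deriv_compatible R (quotient_module L N) \<beta>)"

context right_module
begin

lemma submodule_abelian_subgroup: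
  assumes "submodule N R M" shows "abelian_subgroup N M"
  using assms by (intro abelian_subgroupI3 additive_subgroupI M.abelian_group_axioms)
    (simp add: submodule_def)

lemma quotient_module_rsmult:
  assumes N: "submodule N R M" and x: "x \<in> carrier M" and r: "r \<in> carrier R"
  shows "(N +>\<^bsub>M\<^esub> x) \<bullet>\<^bsub>quotient_module M N\<^esub> r = N +>\<^bsub>M\<^esub> (x \<bullet>\<^bsub>M\<^esub> r)"
proof -
  interpret N: abelian_subgroup N M by (rule submodule_abelian_subgroup[OF N])
  have eq: "N +>\<^bsub>M\<^esub> (y \<bullet>\<^bsub>M\<^esub> r) = N +>\<^bsub>M\<^esub> (x \<bullet>\<^bsub>M\<^esub> r)" if y: "y \<in> N +>\<^bsub>M\<^esub> x" for y
  proof -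
    obtain n where n: "n \<in> N" "y = n \<oplus>\<^bsub>M\<^esub> x"
      using y by (auto simp: a_r_coset_def')
    then have "y \<bullet>\<^bsub>M\<^esub> r = n \<bullet>\<^bsub>M\<^esub> r \<oplus>\<^bsub>M\<^esub> x \<bullet>\<^bsub>M\<^esub> r"
      using x r by (simp add: rsmult_l_distr)
    moreover have "n \<bullet>\<^bsub>M\<^esub> r \<in> N"
      using submodule.smult_closed[OF N r n(1)] .
    ultimately have "y \<bullet>\<^bsub>M\<^esub> r \<in> N +>\<^bsub>M\<^esub> (x \<bullet>\<^bsub>M\<^esub> r)"
      by (auto simp: a_r_coset_def')
    then show ?thesis
      using x r M.a_repr_independence N.a_subgroup rsmult_closed by metis
  qed
  have "(\<Union>y\<in>N +>\<^bsub>M\<^esub> x. N +>\<^bsub>M\<^esub> (y \<bullet>\<^bsub>M\<^esub> r)) = N +>\<^bsub>M\<^esub> (x \<bullet>\<^bsub>M\<^esub> r)"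
    using eq N.a_rcos_self[OF x] by blast
  then show ?thesis by (simp add: quotient_module_def)
qed

lemma quotient_module_right_module:
  assumes N: "submodule N R M" shows "right_module R (quotient_module M N)"
proof -
  interpret N: abelian_subgroup N M by (rule submodule_abelian_subgroup[OF N])
  let ?Q = "quotient_module M N"
  have carr: "carrier ?Q = (\<lambda>x. N +>\<^bsub>M\<^esub> x) ` carrier M"
    by (auto simp: quotient_module_def A_RCOSETS_def' a_r_coset_def')
  have add: "(N +>\<^bsub>M\<^esub> x) \<oplus>\<^bsub>?Q\<^esub> (N +>\<^bsub>M\<^esub> y) = N +>\<^bsub>M\<^esub> (x \<oplus>\<^bsub>M\<^esub> y)"
    if "x \<in> carrier M" "y \<in> carrier M" for x y
    using that by (simp add: quotient_module_def N.a_rcos_sum)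
  have zero: "\<zero>\<^bsub>?Q\<^esub> = N +>\<^bsub>M\<^esub> \<zero>\<^bsub>M\<^esub>"
    using N.a_subset by (simp add: quotient_module_def M.a_coset_add_zero)
  note smult = quotient_module_rsmult[OF N]
  have ex: "\<exists>x\<in>carrier M. X = N +>\<^bsub>M\<^esub> x" if "X \<in> carrier ?Q" for X
    using that unfolding carr by blast
  have mem: "N +>\<^bsub>M\<^esub> x \<in> carrier ?Q" if "x \<in> carrier M" for x
    using that unfolding carr by blast
  have "abelian_group ?Q"
  proof (rule abelian_groupI)
    fix X Y Z assume "X \<in> carrier ?Q" "Y \<in> carrier ?Q" "Z \<in> carrier ?Q"
    then obtain x y z where xyz: "x \<in> carrier M" "y \<in> carrier M" "z \<in> carrier M"
      "X = N +>\<^bsub>M\<^esub> x" "Y = N +>\<^bsub>M\<^esub> y" "Z = N +>\<^bsub>M\<^esub> z"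
      using ex by metis
    then show "(X \<oplus>\<^bsub>?Q\<^esub> Y) \<oplus>\<^bsub>?Q\<^esub> Z = X \<oplus>\<^bsub>?Q\<^esub> (Y \<oplus>\<^bsub>?Q\<^esub> Z)"
      by (simp add: add M.a_assoc)
  next
    fix X Y assume "X \<in> carrier ?Q" "Y \<in> carrier ?Q"
    then obtain x y where xy: "x \<in> carrier M" "y \<in> carrier M"
      "X = N +>\<^bsub>M\<^esub> x" "Y = N +>\<^bsub>M\<^esub> y"
      using ex by metis
    then show "X \<oplus>\<^bsub>?Q\<^esub> Y \<in> carrier ?Q" by (simp add: add mem)
    show "X \<oplus>\<^bsub>?Q\<^esub> Y = Y \<oplus>\<^bsub>?Q\<^esub> X" using xy by (simp add: add M.a_comm)
  next
    fix X assume "X \<in> carrier ?Q"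
    then obtain x where x: "x \<in> carrier M" "X = N +>\<^bsub>M\<^esub> x" using ex by metis
    then show "\<zero>\<^bsub>?Q\<^esub> \<oplus>\<^bsub>?Q\<^esub> X = X" by (simp add: add zero)
    have "(N +>\<^bsub>M\<^esub> (\<ominus>\<^bsub>M\<^esub> x)) \<oplus>\<^bsub>?Q\<^esub> X = \<zero>\<^bsub>?Q\<^esub>"
      using x by (simp add: add zero M.l_neg)
    then show "\<exists>Y\<in>carrier ?Q. Y \<oplus>\<^bsub>?Q\<^esub> X = \<zero>\<^bsub>?Q\<^esub>"
      using mem[OF M.a_inv_closed[OF x(1)]] by blast
  next
    show "\<zero>\<^bsub>?Q\<^esub> \<in> carrier ?Q" unfolding zero by (simp add: mem)
  qed
  moreover have "right_module_axioms R ?Q"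
  proof (rule right_module_axioms.intro)
    fix X Y a assume "X \<in> carrier ?Q" "Y \<in> carrier ?Q" and a: "a \<in> carrier R"
    then obtain x y where xy: "x \<in> carrier M" "y \<in> carrier M"
      "X = N +>\<^bsub>M\<^esub> x" "Y = N +>\<^bsub>M\<^esub> y"
      using ex by metis
    show "(X \<oplus>\<^bsub>?Q\<^esub> Y) \<bullet>\<^bsub>?Q\<^esub> a = X \<bullet>\<^bsub>?Q\<^esub> a \<oplus>\<^bsub>?Q\<^esub> Y \<bullet>\<^bsub>?Q\<^esub> a"
      using xy a by (simp add: add smult rsmult_closed rsmult_l_distr)
  next
    fix X a b assume "X \<in> carrier ?Q" and ab: "a \<in> carrier R" "b \<in> carrier R"
    then obtain x where x: "x \<in> carrier M" "X = N +>\<^bsub>M\<^esub> x" using ex by metis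
    show "X \<bullet>\<^bsub>?Q\<^esub> (a \<oplus>\<^bsub>R\<^esub> b) = X \<bullet>\<^bsub>?Q\<^esub> a \<oplus>\<^bsub>?Q\<^esub> X \<bullet>\<^bsub>?Q\<^esub> b"
      using x ab by (simp add: add smult rsmult_closed rsmult_r_distr)
    show "X \<bullet>\<^bsub>?Q\<^esub> (a \<otimes>\<^bsub>R\<^esub> b) = (X \<bullet>\<^bsub>?Q\<^esub> a) \<bullet>\<^bsub>?Q\<^esub> b"
      using x ab by (simp add: smult rsmult_closed rsmult_assoc)
  next
    fix X a assume "X \<in> carrier ?Q" and a: "a \<in> carrier R"
    then obtain x where x: "x \<in> carrier M" "X = N +>\<^bsub>M\<^esub> x" using ex by metis
    show "X \<bullet>\<^bsub>?Q\<^esub> a \<in> carrier ?Q"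
      using x a by (simp add: smult rsmult_closed mem)
  next
    fix X assume "X \<in> carrier ?Q"
    then obtain x where x: "x \<in> carrier M" "X = N +>\<^bsub>M\<^esub> x" using ex by metis
    show "X \<bullet>\<^bsub>?Q\<^esub> \<one>\<^bsub>R\<^esub> = X"
      using x by (simp add: smult rsmult_one)
  qed
  ultimately show ?thesis
    by (intro right_module.intro R.ring_axioms)
qed

end

end

theory Submission
  imports Defs
begin

text \<open>Complete compatibility is a condition on each quotient Q = M/N separately, so N can be
  fixed and the argument carried out inside Q. Since \<open>\<sigma>\<close>-compatibility is an
  equivalence and \<open>\<sigma>\<close> is onto, evaluating it at the preimage of r yields
  compatibility with the inverse (\<open>endo_compatible_inv_into\<close>). If mr = 0 in Q, then m
  kills the preimage of r, hence its image under \<open>\<delta>\<close>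
  (\<open>deriv_compatible_comp\<close>), hence the negative of that image
  (\<open>deriv_compatible_minus\<close>).\<close>

context right_module
begin

lemma rsmult_zero:
  assumes x: "x \<in> carrier M" shows "x \<bullet>\<^bsub>M\<^esub> \<zero>\<^bsub>R\<^esub> = \<zero>\<^bsub>M\<^esub>"
proof -
  have "x \<bullet>\<^bsub>M\<^esub> \<zero>\<^bsub>R\<^esub> = x \<bullet>\<^bsub>M\<^esub> \<zero>\<^bsub>R\<^esub> \<oplus>\<^bsub>M\<^esub> x \<bullet>\<^bsub>M\<^esub> \<zero>\<^bsub>R\<^esub>"
    using rsmult_r_distr[OF x R.zero_closed R.zero_closed] by simp
  then show ?thesis
    using M.add.r_cancel_one'[OF rsmult_closed rsmult_closed] x by blast
qed

lemma rsmult_minus_eq_zero: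
  assumes x: "x \<in> carrier M" and a: "a \<in> carrier R" and xa: "x \<bullet>\<^bsub>M\<^esub> a = \<zero>\<^bsub>M\<^esub>"
  shows "x \<bullet>\<^bsub>M\<^esub> (\<ominus>\<^bsub>R\<^esub> a) = \<zero>\<^bsub>M\<^esub>"
proof -
  have "x \<bullet>\<^bsub>M\<^esub> (a \<oplus>\<^bsub>R\<^esub> \<ominus>\<^bsub>R\<^esub> a) = x \<bullet>\<^bsub>M\<^esub> (\<ominus>\<^bsub>R\<^esub> a)"
    using x a xa by (subst rsmult_r_distr) (simp_all add: rsmult_closed)
  then show ?thesis
    using x a by (simp add: R.r_neg rsmult_zero)
qed

text \<open>The annihilator of an element of M is closed under negation; this accounts for the sign
  in the derivation \<open>- \<delta> \<sigma>^-1\<close>.\<close>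

lemma deriv_compatible_minus:
  assumes "deriv_compatible R M \<beta>" and "\<beta> \<in> carrier R \<rightarrow> carrier R"
  shows "deriv_compatible R M (\<lambda>r. \<ominus>\<^bsub>R\<^esub> \<beta> r)"
  using assms by (auto simp: deriv_compatible_def intro!: rsmult_minus_eq_zero)

end

lemma endo_compatible_inv_into:
  assumes "endo_compatible R L \<alpha>" and "bij_betw \<alpha> (carrier R) (carrier R)"
  shows "endo_compatible R L (inv_into (carrier R) \<alpha>)"
  unfolding endo_compatible_def
proof (intro ballI)
  fix m r assume m: "m \<in> carrier L" and r: "r \<in> carrier R"
  \<comment> \<open>With s the preimage of r, the hypothesis at s says ms = 0 iff mr = 0, which is
    the goal read backwards.\<close>
  have "inv_into (carrier R) \<alpha> r \<in> carrier R" "\<alpha> (inv_into (carrier R) \<alpha> r) = r"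
    using assms(2) r bij_betw_inv_into[THEN bij_betwE] bij_betw_inv_into_right by fast+
  then show "m \<bullet>\<^bsub>L\<^esub> r = \<zero>\<^bsub>L\<^esub> \<longleftrightarrow> m \<bullet>\<^bsub>L\<^esub> inv_into (carrier R) \<alpha> r = \<zero>\<^bsub>L\<^esub>"
    using assms(1) m unfolding endo_compatible_def by metis
qed

text \<open>Annihilation passes from r to \<open>\<alpha> r\<close> by the forward half of the
  equivalence, then on to \<open>\<beta> (\<alpha> r)\<close>.\<close>

lemma deriv_compatible_comp:
  assumes "endo_compatible R L \<alpha>" and "deriv_compatible R L \<beta>"
    and "\<alpha> \<in> carrier R \<rightarrow> carrier R"
  shows "deriv_compatible R L (\<lambda>r. \<beta> (\<alpha> r))"
  using assms unfolding endo_compatible_def deriv_compatible_def by blast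

theorem proposition3p5:
  fixes R (structure) and M (structure) and \<sigma> \<delta>
  assumes "ring R"
    and "\<sigma> \<in> ring_hom R R"
    and "skew_derivation R \<sigma> \<delta>"
    and "right_module R M"
    and "bij_betw \<sigma> (carrier R) (carrier R)"
    and "completely_compatible R M \<sigma> \<delta>"
  shows "completely_compatible R M (inv_into (carrier R) \<sigma>)
           (\<lambda>r. \<ominus>\<^bsub>R\<^esub> \<delta> (inv_into (carrier R) \<sigma> r))"
  unfolding completely_compatible_def
proof (intro allI impI conjI)
  fix N assume N: "submodule N R M"
  let ?Q = "quotient_module M N" and ?\<sigma>' = "inv_into (carrier R) \<sigma>"
  \<comment> \<open>The negation step uses the module laws, so it has to be available in the
    quotient rather than in M.\<close>
  interpret Q: right_module R ?Q
    using right_module.quotient_module_right_module[OF assms(4) N] .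
  have compat: "endo_compatible R ?Q \<sigma>" "deriv_compatible R ?Q \<delta>"
    using assms(6) N by (auto simp: completely_compatible_def)
  have \<sigma>': "?\<sigma>' \<in> carrier R \<rightarrow> carrier R"
    using bij_betw_inv_into[OF assms(5)] bij_betw_imp_funcset by blast
  have \<delta>: "\<delta> \<in> carrier R \<rightarrow> carrier R"
    using assms(3) by (simp add: skew_derivation_def)
  show endo: "endo_compatible R ?Q ?\<sigma>'"
    using endo_compatible_inv_into[OF compat(1) assms(5)] .
  show "deriv_compatible R ?Q (\<lambda>r. \<ominus>\<^bsub>R\<^esub> \<delta> (?\<sigma>' r))"
    \<comment> \<open>The inverse of \<open>\<sigma>\<close> takes the role of
      \<open>\<alpha>\<close> here, so the half just proved feeds this one.\<close>
    using Q.deriv_compatible_minus[OF deriv_compatible_comp[OF endo compat(2) \<sigma>']] \<sigma>' \<delta>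
    by auto
qed

end
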